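(* There exists an Artinian super-ring $R$ with an odd regular element $y\in R_1$ such that $$\mathrm{sdim}_1(R/Ry)<\mathrm{sdim}_1(R)-1.$$
   Context: A super-ring is a unital associative $\mathbb{Z}_2$-graded ring $R=R_0\oplus R_1$, super-commutative: $ab=(-1)^{|a||b|}ba$ for homogeneous $a,b$, and $a^2=0$ for odd $a$. $R$ is Artinian if it satisfies the descending chain condition on superideals ($\mathbb{Z}_2$-graded ideals). An odd element $y\in R_1$ is regular if $\{r\in R\mid yr=0\}=yR$. For a super-ring $S$ with $\mathrm{Kdim}(S_0)<\infty$, odd elements $y_1,\dots,y_s\in S_1$ ($s\ge1$) form a system of odd parameters if $\mathrm{Kdim}(S_0/\mathrm{Ann}_{S_0}(y_1\cdots y_s))=\mathrm{Kdim}(S_0)$; $\mathrm{sdim}_1(S)=\mathrm{Ksdim}_1(S)$ is the supremum of lengths of systems of odd parameters of $S$ ($0$ if there are none). *)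

theory Defs
  imports "HOL-Algebra.Algebra" "HOL-Library.Extended_Nat" "HOL-Library.Extended_Real"
begin

record 'a sring = "'a ring" +
  even_part :: "'a set"
  odd_part :: "'a set"

locale super_ring = ring R for R :: "('a, 'm) sring_scheme" (structure) +
  assumes even_subgroup: "additive_subgroup (even_part R) R"
    and odd_subgroup: "additive_subgroup (odd_part R) R"
    and parts_sum: "carrier R = even_part R <+>\<^bsub>R\<^esub> odd_part R"
    and parts_direct: "even_part R \<inter> odd_part R = {\<zero>}"
    and even_even: "\<lbrakk>a \<in> even_part R; b \<in> even_part R\<rbrakk> \<Longrightarrow> a \<otimes> b \<in> even_part R"
    and even_odd: "\<lbrakk>a \<in> even_part R; b \<in> odd_part R\<rbrakk> \<Longrightarrow> a \<otimes> b \<in> odd_part R"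
    and odd_even: "\<lbrakk>a \<in> odd_part R; b \<in> even_part R\<rbrakk> \<Longrightarrow> a \<otimes> b \<in> odd_part R"
    and odd_odd: "\<lbrakk>a \<in> odd_part R; b \<in> odd_part R\<rbrakk> \<Longrightarrow> a \<otimes> b \<in> even_part R"
    and even_even_commute: "\<lbrakk>a \<in> even_part R; b \<in> even_part R\<rbrakk> \<Longrightarrow> a \<otimes> b = b \<otimes> a"
    and even_odd_commute: "\<lbrakk>a \<in> even_part R; b \<in> odd_part R\<rbrakk> \<Longrightarrow> a \<otimes> b = b \<otimes> a"
    and odd_odd_anticommute: "\<lbrakk>a \<in> odd_part R; b \<in> odd_part R\<rbrakk> \<Longrightarrow> a \<otimes> b = \<ominus> (b \<otimes> a)"
    and odd_square: "a \<in> odd_part R \<Longrightarrow> a \<otimes> a = \<zero>"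

definition superideal :: "'a set \<Rightarrow> ('a, 'm) sring_scheme \<Rightarrow> bool" where
  "superideal I R \<longleftrightarrow>
     ideal I R \<and> I = (I \<inter> even_part R) <+>\<^bsub>R\<^esub> (I \<inter> odd_part R)"

definition artinian_super_ring :: "('a, 'm) sring_scheme \<Rightarrow> bool" where
  "artinian_super_ring R \<longleftrightarrow> super_ring R \<and>
     (\<forall>I :: nat \<Rightarrow> 'a set.
        (\<forall>n. superideal (I n) R \<and> I (Suc n) \<subseteq> I n) \<longrightarrow> (\<exists>N. \<forall>n\<ge>N. I n = I N))"

definition odd_regular :: "('a, 'm) sring_scheme \<Rightarrow> 'a \<Rightarrow> bool" where
  "odd_regular R y \<longleftrightarrow> y \<in> odd_part R \<and>
     {r \<in> carrier R. y \<otimes>\<^bsub>R\<^esub> r = \<zero>\<^bsub>R\<^esub>} = {y \<otimes>\<^bsub>R\<^esub> r | r. r \<in> carrier R}"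

definition super_quot :: "('a, 'm) sring_scheme \<Rightarrow> 'a set \<Rightarrow> 'a set sring" where
  "super_quot R I = ring.extend (R Quot I)
     (sring.fields ((\<lambda>a. I +>\<^bsub>R\<^esub> a) ` even_part R) ((\<lambda>a. I +>\<^bsub>R\<^esub> a) ` odd_part R))"

(* Supremum of the lengths n of chains P 0 < ... < P n of prime ideals.  It is taken in ereal,
   so that the zero ring, which has no prime ideals, has dimension -\<infinity>.  With the value 0
   (the supremum of the empty set in enat) every list of odd elements of a ring with
   zero-dimensional even part would be a system of odd parameters. *)
definition Kdim :: "('a, 'm) ring_scheme \<Rightarrow> ereal" where
  "Kdim A = Sup {ereal (real n) | n. \<exists>P :: nat \<Rightarrow> 'a set.
     (\<forall>i\<le>n. primeideal (P i) A) \<and> (\<forall>i<n. P i \<subset> P (Suc i))}"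

definition even_ring :: "('a, 'm) sring_scheme \<Rightarrow> ('a, 'm) sring_scheme" where
  "even_ring S = S\<lparr>carrier := even_part S\<rparr>"

definition even_Ann :: "('a, 'm) sring_scheme \<Rightarrow> 'a \<Rightarrow> 'a set" where
  "even_Ann S a = {r \<in> even_part S. r \<otimes>\<^bsub>S\<^esub> a = \<zero>\<^bsub>S\<^esub>}"

definition odd_parameters :: "('a, 'm) sring_scheme \<Rightarrow> 'a list \<Rightarrow> bool" where
  "odd_parameters S ys \<longleftrightarrow>
     Kdim (even_ring S) < \<infinity> \<and> ys \<noteq> [] \<and> set ys \<subseteq> odd_part S \<and>
     Kdim (even_ring S Quot even_Ann S (foldr (\<otimes>\<^bsub>S\<^esub>) ys \<one>\<^bsub>S\<^esub>)) = Kdim (even_ring S)"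

(* In enat the supremum of the empty set is 0, as required when there are no systems. *)
definition sdim1 :: "('a, 'm) sring_scheme \<Rightarrow> enat" where
  "sdim1 S = Sup {enat (length ys) | ys. odd_parameters S ys}"

end

(* Let y be odd and R be spanned over the field with two elements by the monomials m and y m, where
   m is 1, z_i, z_i z_j, z_i z_j z_k / y or z_1 z_2 z_3 z_4 / y for odd generators z_1, ..., z_4.
   This is a subquotient of F_2[z_1, ..., z_4, y, 1/y] / (z_i^2): if v(m) is the least exponent of y
   with which a product m of the z_i occurs, i.e. 0 in degree at most 2 and -1 in degrees 3 and 4,
   then v(m) + v(m') >= v(m m') whenever m m' is nonzero, so that the span of the m y^e with
   e >= v(m) is a ring and that of the m y^e with e >= v(m) + 2 is an ideal in it.  Then R is free
   over F_2[y]/(y^2), which means that y is regular, and z_1 z_2 z_3 z_4 is nonzero in R.  In R/Ry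
   any product of three odd elements is zero: only the z_i and z_1 z_2 z_3 z_4 / y are odd, and
   z_i z_j z_k = y (z_i z_j z_k / y).  Every square in R is zero or one, so the even part has a unique
   prime ideal and a sequence of odd elements is a system of parameters iff its product is nonzero.

   Monomials are represented by natural number weights, so that they multiply by adding weights and
   the parity is that of the weight. *)

theory Submission
  imports Defs "HOL-Library.Z2" "HOL-Computational_Algebra.Formal_Power_Series"
begin

section \<open>Rings in which every square is zero or one\<close>

text \<open>Squaring is multiplicative, which settles multiples and primeness. For sums, if a and b
  have square zero, then (a + b)^2 = 2ab. If this were \<open>\<one>\<close>, so would be its square
  4 a^2 b^2, which is zero.\<close>

lemma cring_square_zero_primeideal:
  fixes A (structure)
  assumes "cring A" and sq: "\<And>x. x \<in> carrier A \<Longrightarrow> x \<otimes> x \<in> {\<zero>, \<one>}" and "\<one> \<noteq> \<zero>"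
  shows "primeideal {x \<in> carrier A. x \<otimes> x = \<zero>} A"
proof -
  interpret cring A by fact
  have mult_sq: "(a \<otimes> b) \<otimes> (a \<otimes> b) = (a \<otimes> a) \<otimes> (b \<otimes> b)"
    if "a \<in> carrier A" "b \<in> carrier A" for a b
    using that by algebra
  have add: "(a \<oplus> b) \<otimes> (a \<oplus> b) = \<zero>"
    if a: "a \<in> carrier A" "a \<otimes> a = \<zero>" and b: "b \<in> carrier A" "b \<otimes> b = \<zero>" for a b
  proof (rule ccontr)
    assume "\<not> ?thesis"
    with sq[of "a \<oplus> b"] a b have one: "(a \<oplus> b) \<otimes> (a \<oplus> b) = \<one>" by auto
    have "(a \<oplus> b) \<otimes> (a \<oplus> b) = a \<otimes> a \<oplus> b \<otimes> b \<oplus> (a \<otimes> b \<oplus> a \<otimes> b)"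
      using a(1) b(1) by algebra
    then have "a \<otimes> b \<oplus> a \<otimes> b = \<one>" using one a b by simp
    moreover have "(a \<otimes> b \<oplus> a \<otimes> b) \<otimes> (a \<otimes> b \<oplus> a \<otimes> b) =
        (a \<otimes> a) \<otimes> (b \<otimes> b) \<oplus> (a \<otimes> a) \<otimes> (b \<otimes> b) \<oplus> ((a \<otimes> a) \<otimes> (b \<otimes> b) \<oplus> (a \<otimes> a) \<otimes> (b \<otimes> b))"
      using a(1) b(1) by algebra
    ultimately show False using a b \<open>\<one> \<noteq> \<zero>\<close> by simp
  qed
  have "ideal {x \<in> carrier A. x \<otimes> x = \<zero>} A"
  proof (rule idealI)
    show "ring A" by unfold_locales
    show "subgroup {x \<in> carrier A. x \<otimes> x = \<zero>} (add_monoid A)"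
    proof (rule add.subgroupI)
      show "{x \<in> carrier A. x \<otimes> x = \<zero>} \<noteq> {}" using zero_closed l_null[OF zero_closed] by blast
    qed (auto simp: add l_minus r_minus)
    show "x \<otimes> a \<in> {x \<in> carrier A. x \<otimes> x = \<zero>}" "a \<otimes> x \<in> {x \<in> carrier A. x \<otimes> x = \<zero>}"
      if "a \<in> {x \<in> carrier A. x \<otimes> x = \<zero>}" "x \<in> carrier A" for a x
      using that mult_sq[of a x] mult_sq[of x a] by auto
  qed
  then show ?thesis
  proof (rule primeidealI)
    show "cring A" by fact
    show "carrier A \<noteq> {x \<in> carrier A. x \<otimes> x = \<zero>}"
      using \<open>\<one> \<noteq> \<zero>\<close> one_closed l_one[OF one_closed] by force
    show "a \<in> {x \<in> carrier A. x \<otimes> x = \<zero>} \<or> b \<in> {x \<in> carrier A. x \<otimes> x = \<zero>}"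
      if "a \<in> carrier A" "b \<in> carrier A" "a \<otimes> b \<in> {x \<in> carrier A. x \<otimes> x = \<zero>}" for a b
      using that sq[of a] sq[of b] mult_sq[of a b] \<open>\<one> \<noteq> \<zero>\<close> by auto
  qed
qed

text \<open>A prime ideal contains every square-zero element and, being proper, no element of square
  \<open>\<one>\<close>. So there is at most one prime ideal.\<close>

lemma primeideal_eq_square_zero:
  fixes A (structure)
  assumes "primeideal P A" and sq: "\<And>x. x \<in> carrier A \<Longrightarrow> x \<otimes> x \<in> {\<zero>, \<one>}"
  shows "P = {x \<in> carrier A. x \<otimes> x = \<zero>}"
proof -
  interpret primeideal P A by fact
  have "\<one> \<notin> P" using I_notcarr one_imp_carrier by blast
  then have "x \<otimes> x = \<zero>" if "x \<in> P" for x
    using that sq[of x] Icarr[OF that] I_l_closed[OF that Icarr[OF that]] by auto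
  moreover have "x \<in> P" if "x \<in> carrier A" "x \<otimes> x = \<zero>" for x
    using that I_prime[of x x] additive_subgroup.zero_closed[OF is_additive_subgroup] by auto
  ultimately show ?thesis using Icarr by blast
qed

text \<open>With a single prime ideal, all chains have length \<open>0\<close>. The zero ring has no
  chain, and the supremum of the empty set in \<open>ereal\<close> is \<open>-\<infinity>\<close>.
  This difference later separates nonzero products from zero ones.\<close>

lemma Kdim_square_zero_or_one:
  fixes A (structure)
  assumes "cring A" and sq: "\<And>x. x \<in> carrier A \<Longrightarrow> x \<otimes> x \<in> {\<zero>, \<one>}"
  shows "Kdim A = (if \<one> = \<zero> then -\<infinity> else 0)"
proof (cases "\<one> = \<zero>")
  case True
  interpret cring A by fact
  have "\<not> primeideal P A" for P
  proof
    assume "primeideal P A"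
    then interpret primeideal P A .
    show False
      using I_notcarr one_imp_carrier additive_subgroup.zero_closed[OF is_additive_subgroup] True
      by auto
  qed
  then have "{ereal (real n) | n. \<exists>P :: nat \<Rightarrow> 'a set.
     (\<forall>i\<le>n. primeideal (P i) A) \<and> (\<forall>i<n. P i \<subset> P (Suc i))} = {}" by auto
  then show ?thesis using True by (simp only: Kdim_def) (simp add: bot_ereal_def)
next
  case False
  note prime = cring_square_zero_primeideal[OF assms False]
  have "{ereal (real n) | n. \<exists>P :: nat \<Rightarrow> 'a set.
     (\<forall>i\<le>n. primeideal (P i) A) \<and> (\<forall>i<n. P i \<subset> P (Suc i))} = {0}" (is "?L = _")
  proof
    show "?L \<subseteq> {0}"
    proof clarsimp
      fix n and P :: "nat \<Rightarrow> 'a set"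
      assume P: "\<forall>i\<le>n. primeideal (P i) A" and chain: "\<forall>i<n. P i \<subset> P (Suc i)"
      show "n = 0"
      proof (rule ccontr)
        assume "n \<noteq> 0"
        then have "P 0 \<subset> P 1" "primeideal (P 0) A" "primeideal (P 1) A" using P chain by auto
        then show False
          using primeideal_eq_square_zero[OF _ sq, of "P 0"]
            primeideal_eq_square_zero[OF _ sq, of "P 1"] by blast
      qed
    qed
    show "{0} \<subseteq> ?L"
      using prime by (auto simp: zero_ereal_def intro!: exI[of _ "0::nat"])
  qed
  then show ?thesis using False by (simp only: Kdim_def) simp
qed

section \<open>Systems of odd parameters when even squares are zero or one\<close>

lemma even_ring_simps [simp]:
  "carrier (even_ring S) = even_part S"
  "x \<otimes>\<^bsub>even_ring S\<^esub> y = x \<otimes>\<^bsub>S\<^esub> y" "\<one>\<^bsub>even_ring S\<^esub> = \<one>\<^bsub>S\<^esub>"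
  "x \<oplus>\<^bsub>even_ring S\<^esub> y = x \<oplus>\<^bsub>S\<^esub> y" "\<zero>\<^bsub>even_ring S\<^esub> = \<zero>\<^bsub>S\<^esub>"
  by (simp_all add: even_ring_def)

lemma even_Ann_ideal:
  fixes S (structure)
  assumes "ring S" "subcring (even_part S) S" "p \<in> carrier S"
  shows "ideal (even_Ann S p) (even_ring S)"
proof -
  interpret ring S by fact
  interpret E: subcring "even_part S" S by fact
  have sub: "x \<in> carrier S" if "x \<in> even_part S" for x using that E.subset by auto
  have er: "ring (even_ring S)"
    unfolding even_ring_def by (rule subring_is_ring) (rule E.subring_axioms)
  then interpret Ev: ring "even_ring S" .
  \<comment> \<open>\<open>a_inv\<close> depends on the carrier, so negation in the even ring is
    identified with that of \<open>S\<close> by uniqueness of inverses.\<close>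
  have inv: "a_inv (even_ring S) x = \<ominus> x" if "x \<in> even_part S" for x
  proof -
    have "\<ominus> x \<in> even_part S" by (rule subringE(5)[OF E.subring_axioms that])
    then show ?thesis
      using that l_neg[OF sub[OF that]]
      by (intro Ev.minus_equality) (simp_all add: even_ring_def)
  qed
  note EI = subringE[OF E.subring_axioms]
  have memI: "x \<in> even_Ann S p" if "x \<in> even_part S" "x \<otimes> p = \<zero>" for x
    using that by (simp add: even_Ann_def)
  have memD: "x \<in> even_part S" "x \<in> carrier S" "x \<otimes> p = \<zero>" if "x \<in> even_Ann S p" for x
    using that sub by (simp_all add: even_Ann_def)
  show ?thesis
  proof (rule idealI[OF er])
    show "subgroup (even_Ann S p) (add_monoid (even_ring S))"
    proof (rule Ev.add.subgroupI)
      show "even_Ann S p \<subseteq> carrier (even_ring S)" using memD(1) by auto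
      show "even_Ann S p \<noteq> {}" using memI[OF EI(2) l_null[OF assms(3)]] by blast
      show "\<ominus>\<^bsub>even_ring S\<^esub> a \<in> even_Ann S p" if "a \<in> even_Ann S p" for a
      proof -
        note a = memD[OF that]
        have "\<ominus> a \<in> even_Ann S p"
          by (rule memI[OF EI(5)[OF a(1)]]) (simp add: l_minus a assms(3))
        then show ?thesis by (simp only: inv[OF a(1)])
      qed
      show "a \<oplus>\<^bsub>even_ring S\<^esub> b \<in> even_Ann S p"
        if "a \<in> even_Ann S p" "b \<in> even_Ann S p" for a b
        using memI[OF EI(7)[OF memD(1)[OF that(1)] memD(1)[OF that(2)]]]
          l_distr[OF memD(2)[OF that(1)] memD(2)[OF that(2)] assms(3)]
          memD(3)[OF that(1)] memD(3)[OF that(2)] by simp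
    qed
    fix a x assume "a \<in> even_Ann S p" and "x \<in> carrier (even_ring S)"
    note a = memD[OF this(1)] and x = this(2)[simplified]
    have "x \<otimes> a \<in> even_Ann S p"
      by (rule memI[OF EI(6)[OF x a(1)]]) (simp add: m_assoc[OF sub[OF x] a(2) assms(3)] a(3) sub[OF x])
    then show "x \<otimes>\<^bsub>even_ring S\<^esub> a \<in> even_Ann S p" "a \<otimes>\<^bsub>even_ring S\<^esub> x \<in> even_Ann S p"
      using E.sub_m_comm[OF a(1) x] by simp_all
  qed
qed

text \<open>Let p be the product of the list. The even part has dimension \<open>0\<close>, and its
  quotient by Ann(p) inherits the condition on squares. So the dimensions agree unless the quotient
  is the zero ring, that is, unless \<open>\<one>\<close> annihilates p.\<close>

lemma odd_parameters_iff_product_nonzero: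
  fixes S (structure)
  assumes "ring S" "subcring (even_part S) S" "odd_part S \<subseteq> carrier S" "\<one> \<noteq> \<zero>"
    and sq: "\<And>x. x \<in> even_part S \<Longrightarrow> x \<otimes> x \<in> {\<zero>, \<one>}"
  shows "odd_parameters S ys \<longleftrightarrow>
    ys \<noteq> [] \<and> set ys \<subseteq> odd_part S \<and> foldr (\<otimes>) ys \<one> \<noteq> \<zero>"
proof (cases "set ys \<subseteq> odd_part S")
  case True
  interpret ring S by fact
  interpret E: subcring "even_part S" S by fact
  let ?p = "foldr (\<otimes>) ys \<one>"
  have p: "?p \<in> carrier S" using True assms(3) by (induction ys) auto
  have one_even: "\<one> \<in> even_part S" using subringE(3)[OF E.subring_axioms] .
  have cr: "cring (even_ring S)"
    unfolding even_ring_def by (simp flip: subcring_iff[OF E.subset[simplified]] add: E.subcring_axioms)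
  have K: "Kdim (even_ring S) = 0"
    using Kdim_square_zero_or_one[OF cr] sq assms(4) by simp
  let ?I = "even_Ann S ?p"
  interpret I: ideal ?I "even_ring S" by (rule even_Ann_ideal) (use assms p in auto)
  let ?Q = "even_ring S Quot ?I"
  have "cring ?Q" by (rule I.quotient_is_cring) (rule cr)
  moreover have "x \<otimes>\<^bsub>?Q\<^esub> x \<in> {\<zero>\<^bsub>?Q\<^esub>, \<one>\<^bsub>?Q\<^esub>}" if x: "x \<in> carrier ?Q" for x
  proof -
    obtain a where a: "a \<in> even_part S" "x = ?I +>\<^bsub>even_ring S\<^esub> a"
      using x by (auto simp: FactRing_def A_RCOSETS_def')
    have "x \<otimes>\<^bsub>?Q\<^esub> x = ?I +>\<^bsub>even_ring S\<^esub> (a \<otimes> a)"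
      using a I.rcoset_mult_add[of a a] by (simp add: FactRing_def)
    moreover have "?I +>\<^bsub>even_ring S\<^esub> \<zero> = \<zero>\<^bsub>?Q\<^esub>"
      using I.a_coset_add_zero[OF I.a_subset] by (simp add: FactRing_def)
    moreover have "?I +>\<^bsub>even_ring S\<^esub> \<one> = \<one>\<^bsub>?Q\<^esub>"
      by (simp add: FactRing_def)
    ultimately show ?thesis using sq[OF a(1)] by auto
  qed
  ultimately have "Kdim ?Q = (if \<one>\<^bsub>?Q\<^esub> = \<zero>\<^bsub>?Q\<^esub> then -\<infinity> else 0)"
    by (rule Kdim_square_zero_or_one)
  moreover have "\<one>\<^bsub>?Q\<^esub> = \<zero>\<^bsub>?Q\<^esub> \<longleftrightarrow> \<one> \<in> ?I"
  proof -
    have "\<one>\<^bsub>?Q\<^esub> = \<zero>\<^bsub>?Q\<^esub> \<longleftrightarrow> ?I +>\<^bsub>even_ring S\<^esub> \<one>\<^bsub>even_ring S\<^esub> = ?I"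
      by (simp add: FactRing_def)
    also have "\<dots> \<longleftrightarrow> \<one>\<^bsub>even_ring S\<^esub> \<in> ?I"
      using I.a_rcos_const I.a_rcos_self[of "\<one>\<^bsub>even_ring S\<^esub>"] I.one_closed by auto
    finally show ?thesis by simp
  qed
  moreover have "\<one> \<in> ?I \<longleftrightarrow> ?p = \<zero>"
    using one_even p by (simp add: even_Ann_def)
  ultimately show ?thesis using True K by (auto simp: odd_parameters_def)
qed (simp add: odd_parameters_def)

section \<open>Truncated monomial algebras over the field with two elements\<close>

text \<open>A series over the field with two elements is determined by its support, so sets of
  exponents can stand for series and inherit their ring laws.\<close>

definition set_fps :: "nat set \<Rightarrow> bit fps" where
  "set_fps U = Abs_fps (\<lambda>n. of_bool (n \<in> U))"

definition fps_supp :: "'a::zero fps \<Rightarrow> nat set" where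
  "fps_supp f = {n. fps_nth f n \<noteq> 0}"

lemma set_fps_nth [simp]: "fps_nth (set_fps U) n = of_bool (n \<in> U)"
  by (simp add: set_fps_def)

lemma fps_supp_set_fps [simp]: "fps_supp (set_fps U) = U"
  by (auto simp: fps_supp_def)

lemma set_fps_supp [simp]: "set_fps (fps_supp f) = f"
  by (rule fps_ext) (auto simp: fps_supp_def of_bool_def)

lemma set_fps_empty [simp]: "set_fps {} = 0"
  by (rule fps_ext) simp

lemma set_fps_0 [simp]: "set_fps {0} = 1"
  by (rule fps_ext) simp

lemma bit_fps_add_self [simp]: "f + f = (0 :: bit fps)"
  by (rule fps_ext) (metis bit_2_eq_0 fps_add_nth fps_zero_nth mult_2 mult_zero_left)

lemma fps_supp_add_subset: "fps_supp (f + g) \<subseteq> fps_supp f \<union> fps_supp g" for f g :: "bit fps"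
  by (auto simp: fps_supp_def)

lemma fps_supp_multE:
  fixes f g :: "'a::semiring_0 fps"
  assumes "k \<in> fps_supp (f * g)"
  obtains i j where "i \<in> fps_supp f" "j \<in> fps_supp g" "k = i + j"
proof -
  have "(\<Sum>i=0..k. fps_nth f i * fps_nth g (k - i)) \<noteq> 0"
    using assms by (simp add: fps_supp_def fps_mult_nth)
  then obtain i where "i \<in> {0..k}" "fps_nth f i * fps_nth g (k - i) \<noteq> 0"
    by (meson sum.neutral)
  then show ?thesis
    using that[of i "k - i"] mult_not_zero by (auto simp: fps_supp_def)
qed

text \<open>Frobenius in characteristic 2: in the induction the cross term occurs twice and
  cancels.\<close>

lemma set_fps_square:
  assumes "finite U"
  shows "set_fps U * set_fps U = set_fps ((\<lambda>n. 2 * n) ` U)"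
  using assms
proof (induction U)
  case (insert a U)
  have ins: "set_fps (insert b V) = fps_X ^ b + set_fps V" if "b \<notin> V" for b V
    using that by (intro fps_ext) (auto simp: fps_X_power_iff)
  have "set_fps (insert a U) * set_fps (insert a U) =
      fps_X ^ a * fps_X ^ a + set_fps U * set_fps U + (fps_X ^ a * set_fps U + fps_X ^ a * set_fps U)"
    using ins[OF insert.hyps(2)] by (simp only: distrib_left distrib_right ac_simps)
  also have "\<dots> = set_fps (insert (2 * a) ((\<lambda>n. 2 * n) ` U))"
    using ins[of "2 * a" "(\<lambda>n. 2 * n) ` U"] insert
    by (simp add: image_iff flip: power_add mult_2)
  finally show ?case by simp
qed simp

text \<open>The monomial of weight n is the singleton of n, addition is symmetric difference, and two
  monomials of weights i and j multiply to the one of weight i + j, or to zero if i + j is not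
  in B.\<close>

definition monomial_algebra :: "nat set \<Rightarrow> nat set sring" where
  "monomial_algebra B =
     \<lparr>carrier = Pow B,
      monoid.mult = (\<lambda>U V. fps_supp (set_fps U * set_fps V) \<inter> B),
      monoid.one = {0},
      ring.zero = {},
      ring.add = (\<lambda>U V. fps_supp (set_fps U + set_fps V)),
      even_part = Pow {n \<in> B. even n},
      odd_part = Pow {n \<in> B. odd n}\<rparr>"

text \<open>\<open>add_in_B\<close> makes the truncated product associative: a triple product that
  survives must not be killed at an intermediate step. \<open>double_notin_B\<close> kills the
  squares of all monomials other than \<open>1\<close>. Finiteness gives the descending chain
  condition.\<close>

locale truncation =
  fixes B :: "nat set"
  assumes finite_B: "finite B"
    and zero_in_B: "0 \<in> B"
    and add_in_B: "\<lbrakk>i \<in> B; j \<in> B; k \<in> B; i + j + k \<in> B\<rbrakk> \<Longrightarrow> i + j \<in> B"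
    and double_notin_B: "\<lbrakk>i \<in> B; i \<noteq> 0\<rbrakk> \<Longrightarrow> 2 * i \<notin> B"
begin

abbreviation R :: "nat set sring" where "R \<equiv> monomial_algebra B"

lemma R_simps [simp]:
  "carrier R = Pow B" "\<one>\<^bsub>R\<^esub> = {0}" "\<zero>\<^bsub>R\<^esub> = {}"
  "even_part R = Pow {n \<in> B. even n}" "odd_part R = Pow {n \<in> B. odd n}"
  by (simp_all add: monomial_algebra_def)

lemma add_eq: "U \<oplus>\<^bsub>R\<^esub> V = fps_supp (set_fps U + set_fps V)"
  by (simp add: monomial_algebra_def)

lemma mult_eq: "U \<otimes>\<^bsub>R\<^esub> V = fps_supp (set_fps U * set_fps V) \<inter> B"
  by (simp add: monomial_algebra_def)

lemma mult_subset: "U \<otimes>\<^bsub>R\<^esub> V \<subseteq> B"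
  by (simp add: mult_eq)

lemma add_subset: "U \<oplus>\<^bsub>R\<^esub> V \<subseteq> U \<union> V"
  using fps_supp_add_subset[of "set_fps U" "set_fps V"] by (simp add: add_eq)

lemma multE:
  assumes "k \<in> U \<otimes>\<^bsub>R\<^esub> V"
  obtains i j where "i \<in> U" "j \<in> V" "k = i + j" "k \<in> B"
  using assms by (auto simp: mult_eq elim: fps_supp_multE)

text \<open>Truncating the inner product does not affect weights in \<open>B\<close>: a term
  contributing to \<open>k\<close> has inner weight \<open>a + b\<close> with
  \<open>k - (a + b)\<close> in \<open>W\<close>, so \<open>add_in_B\<close> puts
  \<open>a + b\<close> in \<open>B\<close>.\<close>

lemma set_fps_mult_nth:
  assumes "U \<subseteq> B" "V \<subseteq> B" "W \<subseteq> B" "k \<in> B"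
  shows "fps_nth (set_fps (U \<otimes>\<^bsub>R\<^esub> V) * set_fps W) k = fps_nth (set_fps U * set_fps V * set_fps W) k"
proof -
  have "fps_nth (set_fps (U \<otimes>\<^bsub>R\<^esub> V)) i * fps_nth (set_fps W) (k - i) =
      fps_nth (set_fps U * set_fps V) i * fps_nth (set_fps W) (k - i)" if "i \<le> k" for i
  proof (cases "i \<in> fps_supp (set_fps U * set_fps V) \<and> k - i \<in> W")
    case True
    then obtain a b where "a \<in> U" "b \<in> V" "i = a + b"
      by (auto elim: fps_supp_multE)
    with True assms that have "i \<in> B"
      using add_in_B[of a b "k - i"] by auto
    with True show ?thesis by (auto simp: mult_eq fps_supp_def)
  next
    case False
    then show ?thesis by (auto simp: mult_eq fps_supp_def)
  qed
  then show ?thesis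
    by (simp only: fps_mult_nth[of _ "set_fps W"]) (intro sum.cong, auto)
qed

lemma mult_comm: "U \<otimes>\<^bsub>R\<^esub> V = V \<otimes>\<^bsub>R\<^esub> U"
  by (simp add: mult_eq mult.commute)

lemma mult_assoc:
  assumes "U \<subseteq> B" "V \<subseteq> B" "W \<subseteq> B"
  shows "(U \<otimes>\<^bsub>R\<^esub> V) \<otimes>\<^bsub>R\<^esub> W = U \<otimes>\<^bsub>R\<^esub> (V \<otimes>\<^bsub>R\<^esub> W)"
proof -
  have *: "(U \<otimes>\<^bsub>R\<^esub> V) \<otimes>\<^bsub>R\<^esub> W = fps_supp (set_fps U * set_fps V * set_fps W) \<inter> B"
    if "U \<subseteq> B" "V \<subseteq> B" "W \<subseteq> B" for U V W
    using set_fps_mult_nth[OF that] by (auto simp: mult_eq[of "U \<otimes>\<^bsub>R\<^esub> V"] fps_supp_def)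
  show ?thesis
    \<comment> \<open>By commutativity the right-hand side is the product of V, W, U bracketed to
      the left, a truncation of the same triple product of series.\<close>
    using *[OF assms] *[OF assms(2,3,1)] mult_comm[of U "V \<otimes>\<^bsub>R\<^esub> W"] by (simp add: ac_simps)
qed

section \<open>The truncated algebra as an Artinian super-ring\<close>

lemma cring_R: "cring R"
proof (rule cringI)
  show "abelian_group R"
  proof (rule abelian_groupI)
    \<comment> \<open>In characteristic 2 each element is its own negative.\<close>
    show "\<exists>V\<in>carrier R. V \<oplus>\<^bsub>R\<^esub> U = \<zero>\<^bsub>R\<^esub>" if "U \<in> carrier R" for U
      using that by (intro bexI[of _ U]) (simp_all add: add_eq fps_supp_def)
    show "U \<oplus>\<^bsub>R\<^esub> V \<in> carrier R" if "U \<in> carrier R" "V \<in> carrier R" for U V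
      using that add_subset[of U V] by auto
  qed (simp_all add: add_eq ac_simps)
  show "comm_monoid R"
  proof (rule comm_monoidI)
    show "\<one>\<^bsub>R\<^esub> \<otimes>\<^bsub>R\<^esub> U = U" if "U \<in> carrier R" for U
      using that by (auto simp: mult_eq)
    show "U \<otimes>\<^bsub>R\<^esub> V \<in> carrier R" for U V using mult_subset by simp
    show "(U \<otimes>\<^bsub>R\<^esub> V) \<otimes>\<^bsub>R\<^esub> W = U \<otimes>\<^bsub>R\<^esub> (V \<otimes>\<^bsub>R\<^esub> W)"
      if "U \<in> carrier R" "V \<in> carrier R" "W \<in> carrier R" for U V W
      using that mult_assoc[of U V W] by simp
    show "U \<otimes>\<^bsub>R\<^esub> V = V \<otimes>\<^bsub>R\<^esub> U" for U V by (rule mult_comm)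
    show "\<one>\<^bsub>R\<^esub> \<in> carrier R" using zero_in_B by simp
  qed
  show "(U \<oplus>\<^bsub>R\<^esub> V) \<otimes>\<^bsub>R\<^esub> W = U \<otimes>\<^bsub>R\<^esub> W \<oplus>\<^bsub>R\<^esub> V \<otimes>\<^bsub>R\<^esub> W"
    if "U \<in> carrier R" "V \<in> carrier R" "W \<in> carrier R" for U V W
    by (simp add: add_eq mult_eq ring_distribs) (auto simp: fps_supp_def)
qed

sublocale cring R by (rule cring_R)

lemma uminus_R: "U \<subseteq> B \<Longrightarrow> \<ominus>\<^bsub>R\<^esub> U = U"
  by (rule minus_equality) (simp_all add: add_eq fps_supp_def)

text \<open>Frobenius doubles all weights, and only the double of \<open>0\<close> stays in
  \<open>B\<close>.\<close>

lemma square_eq: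
  assumes "U \<subseteq> B"
  shows "U \<otimes>\<^bsub>R\<^esub> U = (if 0 \<in> U then {0} else {})"
proof -
  have "finite U" using assms finite_B finite_subset by blast
  then have "U \<otimes>\<^bsub>R\<^esub> U = (\<lambda>n. 2 * n) ` U \<inter> B"
    by (simp add: mult_eq set_fps_square)
  also have "\<dots> = (if 0 \<in> U then {0} else {})"
  proof -
    have "n = 0" if "n \<in> U" "2 * n \<in> B" for n using that double_notin_B assms by auto
    then show ?thesis using zero_in_B by (auto simp: image_iff)
  qed
  finally show ?thesis .
qed

lemma additive_subgroup_Pow:
  assumes "C \<subseteq> B"
  shows "additive_subgroup (Pow C) R"
proof (rule additive_subgroup.intro, rule add.subgroupI)
  show "U \<oplus>\<^bsub>R\<^esub> V \<in> Pow C" if "U \<in> Pow C" "V \<in> Pow C" for U V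
    using that add_subset[of U V] by auto
  show "\<ominus>\<^bsub>R\<^esub> U \<in> Pow C" if "U \<in> Pow C" for U
    using that assms uminus_R[of U] by auto
qed (use assms in auto)

lemma super_ring_R: "super_ring R"
proof (intro super_ring.intro super_ring_axioms.intro)
  show "ring R" by (rule ring_axioms)
  show "additive_subgroup (even_part R) R" "additive_subgroup (odd_part R) R"
    using additive_subgroup_Pow by auto
  show "carrier R = even_part R <+>\<^bsub>R\<^esub> odd_part R"
  proof
    show "carrier R \<subseteq> even_part R <+>\<^bsub>R\<^esub> odd_part R"
    proof
      fix U assume "U \<in> carrier R"
      then have "{n \<in> U. even n} \<in> even_part R" "{n \<in> U. odd n} \<in> odd_part R" by auto
      moreover have "U = {n \<in> U. even n} \<oplus>\<^bsub>R\<^esub> {n \<in> U. odd n}"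
        by (auto simp: add_eq fps_supp_def)
      ultimately show "U \<in> even_part R <+>\<^bsub>R\<^esub> odd_part R"
        unfolding set_add_def' by blast
    qed
    show "even_part R <+>\<^bsub>R\<^esub> odd_part R \<subseteq> carrier R"
    proof
      fix U assume "U \<in> even_part R <+>\<^bsub>R\<^esub> odd_part R"
      then obtain V W where "V \<in> even_part R" "W \<in> odd_part R" "U = V \<oplus>\<^bsub>R\<^esub> W"
        unfolding set_add_def' by blast
      then show "U \<in> carrier R" using add_subset[of V W] by auto
    qed
  qed
  show "even_part R \<inter> odd_part R = {\<zero>\<^bsub>R\<^esub>}" by auto
  fix U V
  show "U \<otimes>\<^bsub>R\<^esub> V \<in> even_part R" if "U \<in> even_part R" "V \<in> even_part R"
    using that by (auto elim!: multE)
  show "U \<otimes>\<^bsub>R\<^esub> V \<in> odd_part R" if "U \<in> even_part R" "V \<in> odd_part R"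
    using that by (auto elim!: multE)
  show "U \<otimes>\<^bsub>R\<^esub> V \<in> odd_part R" if "U \<in> odd_part R" "V \<in> even_part R"
    using that by (auto elim!: multE)
  show "U \<otimes>\<^bsub>R\<^esub> V \<in> even_part R" if "U \<in> odd_part R" "V \<in> odd_part R"
    using that by (auto elim!: multE)
  show "U \<otimes>\<^bsub>R\<^esub> V = V \<otimes>\<^bsub>R\<^esub> U" by (rule mult_comm)
  then show "U \<otimes>\<^bsub>R\<^esub> V = V \<otimes>\<^bsub>R\<^esub> U" .
  \<comment> \<open>Signs vanish in characteristic 2, so anticommuting means commuting. That odd
    elements have square zero is a separate condition; it holds because they do not contain the
    weight \<open>0\<close>.\<close>
  show "U \<otimes>\<^bsub>R\<^esub> V = \<ominus>\<^bsub>R\<^esub> (V \<otimes>\<^bsub>R\<^esub> U)"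
    using uminus_R[OF mult_subset] mult_comm by simp
  show "U \<otimes>\<^bsub>R\<^esub> U = \<zero>\<^bsub>R\<^esub>" if "U \<in> odd_part R"
    using that by (subst square_eq) auto
qed

lemma artinian_R: "artinian_super_ring R"
  unfolding artinian_super_ring_def
proof (intro conjI allI impI super_ring_R)
  fix I :: "nat \<Rightarrow> nat set set"
  assume I: "\<forall>n. superideal (I n) R \<and> I (Suc n) \<subseteq> I n"
  then have "I n \<subseteq> Pow B" for n
    using ideal.Icarr unfolding superideal_def by fastforce
  then have fin: "finite (I n)" for n
    using finite_B finite_subset by blast
  have anti: "I n \<subseteq> I m" if "m \<le> n" for m n
    using lift_Suc_antimono_le[of I m n] I that by auto
  \<comment> \<open>From an ideal of least cardinality on, inclusions of these finite sets are
    equalities.\<close>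
  define N where "N = arg_min (\<lambda>n. card (I n)) (\<lambda>_. True)"
  have "card (I N) \<le> card (I n)" for n
    unfolding N_def by (rule arg_min_nat_le) simp
  then have "I n = I N" if "n \<ge> N" for n
    using card_seteq[OF fin anti[OF that]] by blast
  then show "\<exists>N. \<forall>n\<ge>N. I n = I N" by blast
qed

lemma subcring_even_part: "subcring (even_part R) R"
proof (rule subcringI)
  show "subring (even_part R) R"
  proof (rule subringI)
    show "\<ominus>\<^bsub>R\<^esub> U \<in> even_part R" if "U \<in> even_part R" for U
      using that uminus_R[of U] by auto
    show "U \<oplus>\<^bsub>R\<^esub> V \<in> even_part R" if "U \<in> even_part R" "V \<in> even_part R" for U V
      using that add_subset[of U V] by auto
    show "U \<otimes>\<^bsub>R\<^esub> V \<in> even_part R" if "U \<in> even_part R" "V \<in> even_part R" for U V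
      using that by (auto elim!: multE)
  qed (use zero_in_B in auto)
qed (rule mult_comm)

lemma square_R: "U \<in> carrier R \<Longrightarrow> U \<otimes>\<^bsub>R\<^esub> U \<in> {\<zero>\<^bsub>R\<^esub>, \<one>\<^bsub>R\<^esub>}"
  by (simp add: square_eq)

lemma singleton_mult:
  assumes "i + j \<in> B"
  shows "{i} \<otimes>\<^bsub>R\<^esub> {j} = {i + j}"
proof -
  have "set_fps {n} = fps_X ^ n" for n
    by (rule fps_ext) (simp add: fps_X_power_iff)
  then show ?thesis
    using assms by (auto simp: mult_eq fps_supp_def simp del: set_fps_0 simp flip: power_add)
qed

lemma odd_parameters_R_iff:
  "odd_parameters R Us \<longleftrightarrow> Us \<noteq> [] \<and> set Us \<subseteq> odd_part R \<and> foldr (\<otimes>\<^bsub>R\<^esub>) Us \<one>\<^bsub>R\<^esub> \<noteq> \<zero>\<^bsub>R\<^esub>"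
proof (rule odd_parameters_iff_product_nonzero)
  show "U \<otimes>\<^bsub>R\<^esub> U \<in> {\<zero>\<^bsub>R\<^esub>, \<one>\<^bsub>R\<^esub>}" if "U \<in> even_part R" for U
    by (rule square_R) (use that in auto)
qed (use subcring_even_part ring_axioms in auto)

section \<open>Quotients by proper ideals\<close>

context
  fixes I :: "nat set set"
  assumes ideal_I: "ideal I R" and one_notin_I: "\<one>\<^bsub>R\<^esub> \<notin> I"
begin

interpretation I: ideal I R by (rule ideal_I)

abbreviation Q :: "nat set set sring" where "Q \<equiv> super_quot R I"

abbreviation proj :: "nat set \<Rightarrow> nat set set" where "proj U \<equiv> I +>\<^bsub>R\<^esub> U"

lemma Q_simps:
  "carrier Q = proj ` carrier R" "\<one>\<^bsub>Q\<^esub> = proj \<one>\<^bsub>R\<^esub>" "\<zero>\<^bsub>Q\<^esub> = I"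
  "even_part Q = proj ` even_part R" "odd_part Q = proj ` odd_part R"
  by (auto simp: super_quot_def ring.defs sring.defs FactRing_def A_RCOSETS_def')

lemma proj_hom: "proj \<in> ring_hom R Q"
  using I.rcos_ring_hom
  by (simp add: ring_hom_def super_quot_def ring.defs)

lemma proj_eq_zero_iff: "U \<in> carrier R \<Longrightarrow> proj U = \<zero>\<^bsub>Q\<^esub> \<longleftrightarrow> U \<in> I"
  using I.a_rcos_const I.a_rcos_self by (auto simp: Q_simps)

lemma ring_Q: "ring Q"
proof -
  have "proj \<zero>\<^bsub>R\<^esub> = \<zero>\<^bsub>Q\<^esub>"
    using proj_eq_zero_iff[OF zero_closed] I.zero_closed by simp
  \<comment> \<open>\<open>proj\<close> is onto, so restricting \<open>Q\<close> to the image of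
    \<open>R\<close> changes nothing, and the image of a ring under a homomorphism is a
    ring.\<close>
  then have "Q\<lparr>carrier := proj ` carrier R, one := proj \<one>\<^bsub>R\<^esub>, zero := proj \<zero>\<^bsub>R\<^esub>\<rparr> = Q"
    by (simp only: Q_simps(1,2)[symmetric]) simp
  then show ?thesis
    using hom_imp_img_subring[OF proj_hom carrier_is_subring] by simp
qed

interpretation proj: ring_hom_ring R Q proj
  by (rule ring_hom_ringI2) (rule ring_axioms ring_Q proj_hom)+

text \<open>Squares in the quotient are images of squares in \<open>R\<close>, hence again zero or
  one, and \<open>I\<close> is proper, so the criterion applies.\<close>

lemma odd_parameters_quot_iff:
  "odd_parameters Q Us \<longleftrightarrow> Us \<noteq> [] \<and> set Us \<subseteq> odd_part Q \<and> foldr (\<otimes>\<^bsub>Q\<^esub>) Us \<one>\<^bsub>Q\<^esub> \<noteq> \<zero>\<^bsub>Q\<^esub>"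
proof (rule odd_parameters_iff_product_nonzero)
  have sub: "even_part R \<subseteq> carrier R" "odd_part R \<subseteq> carrier R" by auto
  show "subcring (even_part Q) Q"
  proof (rule ring.subcringI[OF ring_Q])
    show "subring (even_part Q) Q"
      using proj.img_is_subring[OF subcring.axioms(1)[OF subcring_even_part]] by (simp only: Q_simps)
    show "u \<otimes>\<^bsub>Q\<^esub> v = v \<otimes>\<^bsub>Q\<^esub> u" if uv: "u \<in> even_part Q" "v \<in> even_part Q" for u v
    proof -
      obtain U V where UV: "U \<in> even_part R" "V \<in> even_part R" "u = proj U" "v = proj V"
        using uv unfolding Q_simps by blast
      then show ?thesis
        using sub proj.hom_mult[of U V] proj.hom_mult[of V U] mult_comm[of U V]
        by (metis subsetD)
    qed
  qed
  show "odd_part Q \<subseteq> carrier Q" using sub unfolding Q_simps by blast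
  show "\<one>\<^bsub>Q\<^esub> \<noteq> \<zero>\<^bsub>Q\<^esub>"
    using proj_eq_zero_iff[OF one_closed] one_notin_I unfolding Q_simps by blast
  show "u \<otimes>\<^bsub>Q\<^esub> u \<in> {\<zero>\<^bsub>Q\<^esub>, \<one>\<^bsub>Q\<^esub>}" if u: "u \<in> even_part Q" for u
  proof -
    obtain U where U: "U \<in> carrier R" "u = proj U"
      using u sub unfolding Q_simps by blast
    then have "u \<otimes>\<^bsub>Q\<^esub> u = proj (U \<otimes>\<^bsub>R\<^esub> U)" using proj.hom_mult[of U U] by metis
    then show ?thesis
      using square_R[OF U(1)] proj.hom_zero proj.hom_one by auto
  qed
qed (rule ring_Q)

text \<open>Odd elements of \<open>Q\<close> lift to odd elements of \<open>R\<close>. In a list of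
  length at least three, the first three factors already multiply to zero.\<close>

lemma sdim1_quot_le:
  assumes "\<And>U V W. \<lbrakk>U \<in> odd_part R; V \<in> odd_part R; W \<in> odd_part R\<rbrakk> \<Longrightarrow>
    U \<otimes>\<^bsub>R\<^esub> (V \<otimes>\<^bsub>R\<^esub> W) \<in> I"
  shows "sdim1 Q \<le> 2"
  unfolding sdim1_def
proof (rule Sup_least, clarify)
  fix us assume us: "odd_parameters Q us"
  show "enat (length us) \<le> 2"
  proof (rule ccontr)
    assume "\<not> ?thesis"
    then have "length us \<ge> 3" by (simp add: numeral_eq_enat)
    then obtain u v w ws where eq: "us = u # v # w # ws"
      by (metis One_nat_def Suc_le_length_iff numeral_3_eq_3)
    have odd: "set us \<subseteq> proj ` odd_part R" and nz: "foldr (\<otimes>\<^bsub>Q\<^esub>) us \<one>\<^bsub>Q\<^esub> \<noteq> \<zero>\<^bsub>Q\<^esub>"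
      using us unfolding odd_parameters_quot_iff Q_simps by auto
    obtain U V W where UVW: "U \<in> odd_part R" "V \<in> odd_part R" "W \<in> odd_part R"
      "u = proj U" "v = proj V" "w = proj W"
      using odd unfolding eq by auto
    have car: "U \<in> carrier R" "V \<in> carrier R" "W \<in> carrier R" using UVW(1-3) by auto
    have rest: "foldr (\<otimes>\<^bsub>Q\<^esub>) ws \<one>\<^bsub>Q\<^esub> \<in> carrier Q"
    proof -
      have "set ws \<subseteq> proj ` odd_part R" using odd unfolding eq by simp
      then have "set ws \<subseteq> carrier Q" unfolding Q_simps by (rule order_trans) (rule image_mono, auto)
      then show ?thesis by (induction ws) auto
    qed
    have "u \<otimes>\<^bsub>Q\<^esub> (v \<otimes>\<^bsub>Q\<^esub> w) = proj (U \<otimes>\<^bsub>R\<^esub> (V \<otimes>\<^bsub>R\<^esub> W))"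
      using proj.hom_mult[OF car(1) m_closed[OF car(2,3)]] proj.hom_mult[OF car(2,3)] UVW by simp
    also have "\<dots> = \<zero>\<^bsub>Q\<^esub>"
      using proj_eq_zero_iff assms[OF UVW(1-3)] m_closed car by blast
    finally have "u \<otimes>\<^bsub>Q\<^esub> (v \<otimes>\<^bsub>Q\<^esub> w) = \<zero>\<^bsub>Q\<^esub>" .
    moreover have "u \<in> carrier Q" "v \<in> carrier Q" "w \<in> carrier Q"
      using UVW(4-6) car by auto
    ultimately have "foldr (\<otimes>\<^bsub>Q\<^esub>) us \<one>\<^bsub>Q\<^esub> = \<zero>\<^bsub>Q\<^esub>"
      using rest unfolding eq by (simp flip: proj.S.m_assoc)
    then show False using nz by blast
  qed
qed

end

section \<open>Multiples and annihilator of y, the monomial of weight 1\<close>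

lemma mem_mult_one_iff: "k \<in> U \<otimes>\<^bsub>R\<^esub> {1} \<longleftrightarrow> k \<in> B \<and> 1 \<le> k \<and> k - 1 \<in> U"
proof -
  have "set_fps {1} = fps_X" by (rule fps_ext) (simp add: fps_X_def)
  then show ?thesis by (auto simp: mult_eq fps_supp_def)
qed

text \<open>Multiplication by y shifts weights by one and truncates, so the ideal is spanned by
  monomials. \<open>1 \<le> k\<close> excludes the weight \<open>0\<close>, for which
  \<open>k - 1\<close> is \<open>0\<close> and lies in \<open>B\<close>.\<close>

lemma mem_PIdl_one_iff:
  "U \<in> PIdl\<^bsub>R\<^esub> {1} \<longleftrightarrow> U \<subseteq> B \<and> (\<forall>k\<in>U. 1 \<le> k \<and> k - 1 \<in> B)"
proof
  assume "U \<in> PIdl\<^bsub>R\<^esub> {1}"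
  then obtain V where "V \<subseteq> B" "U = V \<otimes>\<^bsub>R\<^esub> {1}" by (auto simp: cgenideal_def)
  then show "U \<subseteq> B \<and> (\<forall>k\<in>U. 1 \<le> k \<and> k - 1 \<in> B)" using mem_mult_one_iff by blast
next
  assume U: "U \<subseteq> B \<and> (\<forall>k\<in>U. 1 \<le> k \<and> k - 1 \<in> B)"
  \<comment> \<open>The cofactor of y is \<open>U\<close> shifted down by one.\<close>
  have "k \<in> U \<longleftrightarrow> k \<in> {n \<in> B. n + 1 \<in> U} \<otimes>\<^bsub>R\<^esub> {1}" for k
    unfolding mem_mult_one_iff using U by (cases "1 \<le> k") auto
  then have "U = {n \<in> B. n + 1 \<in> U} \<otimes>\<^bsub>R\<^esub> {1}" by blast
  then show "U \<in> PIdl\<^bsub>R\<^esub> {1}" by (force simp: cgenideal_def)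
qed

text \<open>The hypothesis pairs each monomial with a neighbour, as in a free module over
  F_2[y]/(y^2). Monomials killed by y are those that cannot be shifted up, hence they are multiples
  of y; conversely y^2 = 0.\<close>

lemma odd_regular_one:
  assumes "1 \<in> B" and "\<And>k. \<lbrakk>k \<in> B; k + 1 \<notin> B\<rbrakk> \<Longrightarrow> 1 \<le> k \<and> k - 1 \<in> B"
  shows "odd_regular R {1}"
proof -
  have "2 \<notin> B" using double_notin_B[OF assms(1)] by simp
  \<comment> \<open>Otherwise \<open>1 + 1 + k\<close> would survive, and \<open>add_in_B\<close>
    would force \<open>2\<close> into \<open>B\<close>.\<close>
  have no_two: "k + 2 \<notin> B" if "k \<in> B" for k
    using add_in_B[of 1 1 k] that assms(1) \<open>2 \<notin> B\<close> by (auto simp: add.commute numeral_2_eq_2)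
  have ann: "{1} \<otimes>\<^bsub>R\<^esub> U = \<zero>\<^bsub>R\<^esub> \<longleftrightarrow> U \<in> PIdl\<^bsub>R\<^esub> {1}" if "U \<subseteq> B" for U
  proof
    assume "{1} \<otimes>\<^bsub>R\<^esub> U = \<zero>\<^bsub>R\<^esub>"
    then have "k + 1 \<notin> B" if "k \<in> U" for k
      using that mem_mult_one_iff[of "k + 1" U] mult_comm[of "{1}" U] by auto
    then show "U \<in> PIdl\<^bsub>R\<^esub> {1}"
      using assms(2) \<open>U \<subseteq> B\<close> unfolding mem_PIdl_one_iff by blast
  next
    assume "U \<in> PIdl\<^bsub>R\<^esub> {1}"
    then have U: "1 \<le> n \<and> n - 1 \<in> B" if "n \<in> U" for n
      using that unfolding mem_PIdl_one_iff by blast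
    have "k \<notin> U \<otimes>\<^bsub>R\<^esub> {1}" for k
    proof
      assume "k \<in> U \<otimes>\<^bsub>R\<^esub> {1}"
      then have "k \<in> B" "1 \<le> k" "k - 1 \<in> U" by (simp_all only: mem_mult_one_iff)
      moreover from this have "1 \<le> k - 1" "k - 1 - 1 \<in> B" using U by blast+
      moreover from this have "k - 1 - 1 + 2 = k" by simp
      ultimately show False using no_two[of "k - 1 - 1"] by simp
    qed
    then show "{1} \<otimes>\<^bsub>R\<^esub> U = \<zero>\<^bsub>R\<^esub>"
      using mult_comm[of "{1}" U] by auto
  qed
  have "PIdl\<^bsub>R\<^esub> {1} \<subseteq> carrier R" using mem_PIdl_one_iff by auto
  then have "{U \<in> carrier R. {1} \<otimes>\<^bsub>R\<^esub> U = \<zero>\<^bsub>R\<^esub>} = PIdl\<^bsub>R\<^esub> {1}"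
    using ann unfolding R_simps(1) by blast
  also have "\<dots> = {{1} \<otimes>\<^bsub>R\<^esub> U | U. U \<in> carrier R}"
    unfolding cgenideal_def by (simp only: mult_comm[of "{1}"])
  finally show ?thesis
    using assms(1) by (simp add: odd_regular_def)
qed

end

section \<open>The counterexample\<close>

text \<open>The element y has weight 1 and z1, ..., z4 have weights 33, 49, 57, 63.  The monomials other
  than multiples of y come, in this order, as 1, the zi, the zi zj, the zi zj zk / y (weights 138,
  144, 152, 168) and z1 z2 z3 z4 / y (weight 201); each is followed by its multiple by y.  The
  four numbers were found by computer search: any odd numbers work for which no coincidence
  between sums violates the lemmas below.\<close>

definition weights :: "nat set" where
  "weights =
    {0, 1, 33, 34, 49, 50, 57, 58, 63, 64, 82, 83, 90, 91, 96, 97, 106, 107, 112, 113, 120, 121,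
     138, 139, 144, 145, 152, 153, 168, 169, 201, 202}"

text \<open>The sums of two weights that are at most 202 and are not weights.\<close>

definition non_weight_sums :: "nat set" where
  "non_weight_sums =
    {2, 35, 51, 59, 65, 66, 67, 68, 84, 92, 98, 99, 100, 108, 114, 115, 116, 117, 122, 123, 124,
     125, 126, 127, 128, 129, 130, 131, 132, 133, 140, 141, 146, 147, 148, 149, 154, 155, 156,
     157, 159, 160, 161, 162, 163, 164, 165, 166, 170, 171, 172, 173, 174, 175, 176, 177, 178,
     179, 180, 181, 182, 183, 184, 185, 186, 187, 188, 189, 190, 192, 193, 194, 195, 196, 197,
     198}"

text \<open>Together with the next lemma this turns the condition on triples in
  \<open>add_in_B\<close> into two finite checks over pairs. Sums above 202 are harmless because no
  weight exceeds 202.\<close>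

lemma sum_weights_cases:
  "\<forall>i\<in>weights. \<forall>j\<in>weights. i + j \<in> weights \<or> 202 < i + j \<or> i + j \<in> non_weight_sums"
  unfolding weights_def non_weight_sums_def by simp

lemma non_weight_sums_add: "\<forall>k\<in>weights. \<forall>s\<in>non_weight_sums. s + k \<notin> weights"
  unfolding weights_def non_weight_sums_def by simp

lemma weights_le: "n \<in> weights \<Longrightarrow> n \<le> 202"
  unfolding weights_def by auto

section \<open>Products of odd monomials\<close>

lemma odd_weights:
  "{n \<in> weights. odd n} = {1, 33, 49, 57, 63, 83, 91, 97, 107, 113, 121, 139, 145, 153, 169, 201}"
  unfolding weights_def by auto

text \<open>The first four weights listed are those of the y z_i, the next six those of the z_i z_j,
  and 202 is that of z_1 z_2 z_3 z_4.\<close>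

lemma add_odd_weights:
  assumes "i \<in> {n \<in> weights. odd n}" "j \<in> {n \<in> weights. odd n}" "i + j \<in> weights"
  shows "i + j \<in> {34, 50, 58, 64, 82, 90, 96, 106, 112, 120, 202}"
proof -
  have "\<forall>i\<in>{n \<in> weights. odd n}. \<forall>j\<in>{n \<in> weights. odd n}. i + j \<in> weights \<longrightarrow>
      i + j \<in> {34, 50, 58, 64, 82, 90, 96, 106, 112, 120, 202}"
    unfolding odd_weights unfolding weights_def by simp
  then show ?thesis using assms by blast
qed

text \<open>The surviving products are y z_i z_j and z_i z_j z_k, and the latter is y times z_i z_j
  z_k / y. So products of three odd monomials are multiples of y.\<close>

lemma add_three_odd_weights:
  assumes "i \<in> {n \<in> weights. odd n}" "j \<in> {n \<in> weights. odd n}" "k \<in> {n \<in> weights. odd n}"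
    and "i + j \<in> weights" "i + j + k \<in> weights"
  shows "i + j + k - 1 \<in> weights"
proof -
  have "\<forall>k\<in>{n \<in> weights. odd n}. \<forall>s\<in>{34, 50, 58, 64, 82, 90, 96, 106, 112, 120, 202}.
      s + k \<in> weights \<longrightarrow> s + k - 1 \<in> weights"
    unfolding odd_weights unfolding weights_def by simp
  then show ?thesis
    using assms(3,5) add_odd_weights[OF assms(1,2,4)] by blast
qed

interpretation truncation weights
proof
  show "finite weights" "0 \<in> weights" by (simp_all add: weights_def)
  show "i + j \<in> weights"
    if "i \<in> weights" "j \<in> weights" "k \<in> weights" "i + j + k \<in> weights" for i j k
  proof (rule ccontr)
    assume "i + j \<notin> weights"
    moreover have "i + j \<le> 202" using weights_le[OF that(4)] by simp
    ultimately have "i + j \<in> non_weight_sums"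
      using sum_weights_cases that(1,2) by fastforce
    then show False using non_weight_sums_add that(3,4) by blast
  qed
  have "\<forall>i\<in>weights. i \<noteq> 0 \<longrightarrow> 2 * i \<notin> weights" unfolding weights_def by simp
  then show "2 * i \<notin> weights" if "i \<in> weights" "i \<noteq> 0" for i using that by blast
qed

theorem mainTheorem12:
  shows "\<exists>(R :: nat set sring) y.
    artinian_super_ring R \<and> odd_regular R y \<and>
    sdim1 (super_quot R (PIdl\<^bsub>R\<^esub> y)) < sdim1 R - 1"
proof (intro exI conjI)
  let ?R = "monomial_algebra weights"
  show "artinian_super_ring ?R" by (rule artinian_R)
  have one: "1 \<in> weights" by (simp add: weights_def)
  show "odd_regular ?R {1}"
  proof (rule odd_regular_one)
    show "1 \<in> weights" by (rule one)
    \<comment> \<open>The weights come in consecutive pairs, a monomial and its multiple by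
      y.\<close>
    have "\<forall>k\<in>weights. k + 1 \<in> weights \<or> 1 \<le> k \<and> k - 1 \<in> weights"
      unfolding weights_def by simp
    then show "1 \<le> k \<and> k - 1 \<in> weights" if "k \<in> weights" "k + 1 \<notin> weights" for k
      using that by blast
  qed
  have "sdim1 (super_quot ?R (PIdl\<^bsub>?R\<^esub> {1})) \<le> 2"
  proof (rule sdim1_quot_le)
    show "ideal (PIdl\<^bsub>?R\<^esub> {1}) ?R"
      by (rule cgenideal_ideal) (use one in simp)
    show "\<one>\<^bsub>?R\<^esub> \<notin> PIdl\<^bsub>?R\<^esub> {1}"
      unfolding mem_PIdl_one_iff by simp
    fix U V W assume odd: "U \<in> odd_part ?R" "V \<in> odd_part ?R" "W \<in> odd_part ?R"
    \<comment> \<open>With brackets to the left, \<open>multE\<close> also yields that the partial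
      sum \<open>i + j\<close> is a weight, as \<open>add_three_odd_weights\<close>
      requires.\<close>
    have "1 \<le> n \<and> n - 1 \<in> weights" if n: "n \<in> (U \<otimes>\<^bsub>?R\<^esub> V) \<otimes>\<^bsub>?R\<^esub> W" for n
    proof -
      obtain m k where "m \<in> U \<otimes>\<^bsub>?R\<^esub> V" "k \<in> W" "n = m + k" "n \<in> weights"
        using n by (rule multE)
      moreover obtain i j where "i \<in> U" "j \<in> V" "m = i + j" "m \<in> weights"
        using \<open>m \<in> U \<otimes>\<^bsub>?R\<^esub> V\<close> by (rule multE)
      ultimately have eq: "n = i + j + k" and "n - 1 \<in> weights" and "odd i"
        using odd add_three_odd_weights[of i j k] by auto
      \<comment> \<open>\<open>odd i\<close> makes \<open>n\<close> positive;
        \<open>n - 1 \<in> weights\<close> alone would allow \<open>n = 0\<close>.\<close>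
      then show ?thesis by (cases i) auto
    qed
    then have "(U \<otimes>\<^bsub>?R\<^esub> V) \<otimes>\<^bsub>?R\<^esub> W \<in> PIdl\<^bsub>?R\<^esub> {1}"
      unfolding mem_PIdl_one_iff using mult_subset by blast
    moreover have "(U \<otimes>\<^bsub>?R\<^esub> V) \<otimes>\<^bsub>?R\<^esub> W = U \<otimes>\<^bsub>?R\<^esub> (V \<otimes>\<^bsub>?R\<^esub> W)"
      using odd by (intro mult_assoc) auto
    ultimately show "U \<otimes>\<^bsub>?R\<^esub> (V \<otimes>\<^bsub>?R\<^esub> W) \<in> PIdl\<^bsub>?R\<^esub> {1}" by simp
  qed
  also have "2 < sdim1 ?R - 1"
  proof -
    \<comment> \<open>The product z_1 z_2 z_3 z_4 is accumulated from the right, as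
      \<open>foldr\<close> does. It survives as y times the monomial of weight 201.\<close>
    have "{63} \<otimes>\<^bsub>?R\<^esub> {0} = {63}" "{57} \<otimes>\<^bsub>?R\<^esub> {63} = {120}"
      "{49} \<otimes>\<^bsub>?R\<^esub> {120} = {169}" "{33} \<otimes>\<^bsub>?R\<^esub> {169} = {202}"
      by (subst singleton_mult; simp add: weights_def)+
    moreover have "33 \<in> weights" "49 \<in> weights" "57 \<in> weights" "63 \<in> weights"
      by (simp_all add: weights_def)
    ultimately have "odd_parameters ?R [{33}, {49}, {57}, {63}]"
      unfolding odd_parameters_R_iff by simp
    then have "enat (length [{33}, {49}, {57}, {63::nat}]) \<le> sdim1 ?R"
      unfolding sdim1_def by (intro Sup_upper) blast
    \<comment> \<open>The bound \<open>4 \<le> sdim1 ?R\<close> suffices: an infinite value stays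
      infinite after subtracting \<open>1\<close> in \<open>enat\<close>.\<close>
    then show ?thesis by (cases "sdim1 ?R") (auto simp: one_enat_def numeral_eq_enat)
  qed
  finally show "sdim1 (super_quot ?R (PIdl\<^bsub>?R\<^esub> {1})) < sdim1 ?R - 1" .
qed

end
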